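(* For $0\le\delta\le1$ let $f_\delta=1_{\{0\}}+\delta\,1_{\{1\}}$, a function on $\mathbb{Z}$. Then $\gamma(f_\delta)=1+\delta$, and more generally for $1<p<\infty$ and $1/p+1/q=1$, \[ \gamma_p(f_\delta)\ge\frac{p^{1/p}q^{1/q}}{2}(1+\delta). \]
   Context: For nonnegative functions $f,g$ on $\mathbb{Z}$, $(f\star g)(x)=\max_t f(t)g(x-t)$ (max-convolution). For nonnegative $f\in\ell^1(\mathbb{Z})$, $\gamma_p(f)=\inf_{g,h}\frac{\|f\star g\star h\|_1}{\|g\|_p\|h\|_q}$, the infimum over nonzero nonnegative $g,h\in\ell^1(\mathbb{Z})$, and $\gamma=\gamma_2$. *)

theory Defs
  imports "HOL-Analysis.Analysis"
begin

definition maxconv :: "(int \<Rightarrow> real) \<Rightarrow> (int \<Rightarrow> real) \<Rightarrow> int \<Rightarrow> real" where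
  "maxconv f g x = (SUP t. f t * g (x - t))"

text \<open>The l^p norm (for summable |g|^p).\<close>
definition lp_norm :: "real \<Rightarrow> (int \<Rightarrow> real) \<Rightarrow> real" where
  "lp_norm p g = (\<Sum>\<^sub>\<infinity>x. \<bar>g x\<bar> powr p) powr (1 / p)"

definition nonneg_l1 :: "(int \<Rightarrow> real) \<Rightarrow> bool" where
  "nonneg_l1 g \<longleftrightarrow> (\<forall>x. 0 \<le> g x) \<and> g summable_on UNIV \<and> g \<noteq> (\<lambda>_. 0)"

text \<open>gamma_p(f), q the conjugate exponent p/(p-1).  Pairs for which f*g*h is not
  summable give ratio +infinity and therefore do not affect the infimum.\<close>
definition gamma_p :: "real \<Rightarrow> (int \<Rightarrow> real) \<Rightarrow> real" where
  "gamma_p p f = Inf {(\<Sum>\<^sub>\<infinity>x. maxconv (maxconv f g) h x) / (lp_norm p g * lp_norm (p / (p - 1)) h)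
      | g h. nonneg_l1 g \<and> nonneg_l1 h \<and> maxconv (maxconv f g) h summable_on UNIV}"

definition gamma :: "(int \<Rightarrow> real) \<Rightarrow> real" where
  "gamma f = gamma_p 2 f"

end

theory Submission
  imports Defs
begin

text \<open>
  Extend g and h to the real line by g(n + u) = g(n) \<delta>^u and h(n + u) = h(n) \<delta>^u for
  0 \<le> u < 1. If two fractional parts add up to at least 1, the carry costs exactly the factor \<delta>
  that f attaches to the shift by 1, so the sup-convolution of the extensions is dominated by the
  extension of W = f \<star> g \<star> h. Normalise g and h to have maximum 1. Then the one-dimensional
  Brunn-Minkowski inequality on level sets gives
  (\<Sum>W) \<integral> \<delta>^u du \<ge> (\<Sum>g^p) \<integral> \<delta>^(pu) du + (\<Sum>h^q) \<integral> \<delta>^(qu) du over the unit interval.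
  Weighted AM-GM under the integral bounds the right-hand side below by
  p^(1/p) q^(1/q) \<parallel>g\<parallel>_p \<parallel>h\<parallel>_q \<integral> \<delta>^(2u) du, and
  \<integral> \<delta>^(2u) du = (1 + \<delta>)/2 \<integral> \<delta>^u du. Equality for p = 2 is attained at g = h = 1_{0}.
\<close>

section \<open>Weighted arithmetic and geometric means\<close>

text \<open>Young's inequality for \<open>p powr (1 / p) * x\<close> and
  \<open>q powr (1 / q) * y\<close>: the powers p and q produce factors that cancel its
  denominators. The constant p^(1/p) q^(1/q) of the final bound comes from here.\<close>

lemma weighted_young:
  fixes p q x y :: real
  assumes "1 < p" "1 < q" "1 / p + 1 / q = 1" "0 \<le> x" "0 \<le> y"
  shows "p powr (1 / p) * q powr (1 / q) * x * y \<le> x powr p + y powr q"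
proof -
  have "(p powr (1 / p) * x) * (q powr (1 / q) * y)
      \<le> (p powr (1 / p) * x) powr p / p + (q powr (1 / q) * y) powr q / q"
    using assms by (intro Youngs_inequality) auto
  then show ?thesis
    using assms by (simp add: powr_mult powr_powr mult_ac)
qed

section \<open>The Brunn-Minkowski inequality on the real line\<close>

text \<open>With a = max A and b = min B, the translates A + b and a + B lie in the sumset and meet
  only in a + b, a null set. A Borel set \<open>C\<close> containing the sumset stands in for it,
  since a sumset of Borel sets need not be Borel.\<close>

lemma brunn_minkowski_real_compact:
  fixes A B C :: "real set"
  assumes "compact A" "compact B" "A \<noteq> {}" "B \<noteq> {}" "C \<in> sets borel"
    and C: "\<And>x y. x \<in> A \<Longrightarrow> y \<in> B \<Longrightarrow> x + y \<in> C"
  shows "emeasure lborel A + emeasure lborel B \<le> emeasure lborel C"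
proof -
  obtain a where a: "a \<in> A" "\<And>x. x \<in> A \<Longrightarrow> x \<le> a"
    using compact_attains_sup assms by metis
  obtain b where b: "b \<in> B" "\<And>x. x \<in> B \<Longrightarrow> b \<le> x"
    using compact_attains_inf assms by metis
  have [measurable]: "A \<in> sets borel" "B \<in> sets borel" "C \<in> sets borel"
    using assms by (auto intro: borel_compact)
  have tr: "emeasure lborel ((+) c -` S) = emeasure lborel S" if "S \<in> sets borel" for c :: real and S
    using that by (subst (2) lborel_distr_plus[of c, symmetric]) (simp add: emeasure_distr)
  \<comment> \<open>As preimages, these are A + b and a + (B - {b}).\<close>
  let ?A = "(+) (-b) -` A" and ?B = "(+) (-a) -` (B - {b})"
  have sub: "?A \<union> ?B \<subseteq> C"
  proof (intro Un_least subsetI)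
    fix z assume "z \<in> ?A"
    with C[of "- b + z" b] b show "z \<in> C" by simp
  next
    fix z assume "z \<in> ?B"
    with C[of a "- a + z"] a show "z \<in> C" by simp
  qed
  have disj: "?A \<inter> ?B = {}"
  proof -
    have False if "z \<in> ?A" "z \<in> ?B" for z
      using a(2)[of "- b + z"] b(2)[of "- a + z"] that by auto
    then show ?thesis by blast
  qed
  have [measurable]: "?A \<in> sets borel" "?B \<in> sets borel"
    using measurable_sets[of "(+) (- b)" borel borel A] measurable_sets[of "(+) (- a)" borel borel "B - {b}"]
    by simp_all
  have "emeasure lborel (B - {b}) = emeasure lborel B"
    by (rule emeasure_Diff_null_set) auto
  then have "emeasure lborel A + emeasure lborel B = emeasure lborel ?A + emeasure lborel ?B"
    by (simp add: tr)
  also have "\<dots> = emeasure lborel (?A \<union> ?B)"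
    using disj by (intro plus_emeasure) auto
  also have "\<dots> \<le> emeasure lborel C"
    using sub by (intro emeasure_mono) auto
  finally show ?thesis .
qed

text \<open>Truncation to \<open>{- real n..real n}\<close> gives compact sets, and continuity from
  below of the measure passes to the limit.\<close>

lemma brunn_minkowski_real_closed:
  fixes A B C :: "real set"
  assumes "closed A" "closed B" "A \<noteq> {}" "B \<noteq> {}" "C \<in> sets borel"
    and C: "\<And>x y. x \<in> A \<Longrightarrow> y \<in> B \<Longrightarrow> x + y \<in> C"
  shows "emeasure lborel A + emeasure lborel B \<le> emeasure lborel C"
proof -
  obtain a b where ab: "a \<in> A" "b \<in> B" using assms by auto
  have lim: "(\<lambda>n. emeasure lborel (S \<inter> {- real n..real n})) \<longlonglongrightarrow> emeasure lborel S"
    if "closed S" for S :: "real set"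
  proof -
    have "(\<Union>n. S \<inter> {- real n..real n}) = S"
    proof -
      have "\<exists>n. - real n \<le> x \<and> x \<le> real n" for x :: real
        using real_arch_simple[of "\<bar>x\<bar>"] by (metis abs_le_D1 abs_le_D2 minus_le_iff)
      then show ?thesis by auto
    qed
    moreover have "(\<lambda>n. emeasure lborel (S \<inter> {- real n..real n}))
        \<longlonglongrightarrow> emeasure lborel (\<Union>n. S \<inter> {- real n..real n})"
      using that by (intro Lim_emeasure_incseq) (auto simp: incseq_def)
    ultimately show ?thesis by simp
  qed
  have "eventually (\<lambda>n. emeasure lborel (A \<inter> {- real n..real n}) + emeasure lborel (B \<inter> {- real n..real n})
      \<le> emeasure lborel C) sequentially"
    \<comment> \<open>For such n both truncations still contain a and b, so the compact case, which
      requires nonempty sets, applies.\<close>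
    using eventually_ge_at_top[of "nat \<lceil>max \<bar>a\<bar> \<bar>b\<bar>\<rceil>"]
  proof eventually_elim
    case (elim n)
    then have "\<bar>a\<bar> \<le> real n" "\<bar>b\<bar> \<le> real n" by linarith+
    then have "a \<in> A \<inter> {- real n..real n}" "b \<in> B \<inter> {- real n..real n}"
      using ab by (auto simp: abs_le_iff)
    then show ?case
      using assms by (intro brunn_minkowski_real_compact closed_Int_compact) auto
  qed
  then show ?thesis
    using tendsto_add[OF lim lim, of A B] assms by (intro tendsto_upperbound) auto
qed

text \<open>By inner regularity, A and B contain closed subsets that lose at most e/2 in measure
  each; sums of their points still lie in \<open>C\<close>.\<close>

lemma brunn_minkowski_real:
  fixes A B C :: "real set"
  assumes "A \<in> sets borel" "B \<in> sets borel" "A \<noteq> {}" "B \<noteq> {}" "C \<in> sets borel"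
    and C: "\<And>x y. x \<in> A \<Longrightarrow> y \<in> B \<Longrightarrow> x + y \<in> C"
  shows "emeasure lborel A + emeasure lborel B \<le> emeasure lborel C"
proof (rule ennreal_le_epsilon)
  fix e :: real assume "0 < e"
  have appr: "\<exists>T. closed T \<and> T \<noteq> {} \<and> T \<subseteq> S \<and> emeasure lborel S \<le> emeasure lborel T + ennreal (e / 2)"
    if S: "S \<in> sets borel" "S \<noteq> {}" for S :: "real set"
  proof -
    \<comment> \<open>A null set may have T empty, so a point s of S is added to keep the
      approximating set nonempty.\<close>
    obtain s where s: "s \<in> S" using S by auto
    obtain T where T: "closed T" "T \<subseteq> S" "emeasure lebesgue (S - T) < ennreal (e / 2)"
    proof (rule sets_lebesgue_inner_closed)
      show "S \<in> sets lebesgue" using S by simp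
      show "0 < e / 2" using \<open>0 < e\<close> by simp
    qed
    have "T \<in> sets borel" using T by auto
    have "emeasure lborel S \<le> emeasure lborel (insert s T \<union> (S - T))"
      using S \<open>T \<in> sets borel\<close> by (intro emeasure_mono) auto
    also have "\<dots> \<le> emeasure lborel (insert s T) + emeasure lborel (S - T)"
      using S \<open>T \<in> sets borel\<close> by (intro emeasure_subadditive) auto
    also have "emeasure lborel (S - T) \<le> ennreal (e / 2)"
      using T S \<open>T \<in> sets borel\<close> by (simp add: less_imp_le)
    finally show ?thesis using T s by (intro exI[of _ "insert s T"]) (auto simp: add_left_mono)
  qed
  obtain K where K: "closed K" "K \<noteq> {}" "K \<subseteq> A" "emeasure lborel A \<le> emeasure lborel K + ennreal (e / 2)"
    using appr[OF assms(1,3)] by blast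
  obtain L where L: "closed L" "L \<noteq> {}" "L \<subseteq> B" "emeasure lborel B \<le> emeasure lborel L + ennreal (e / 2)"
    using appr[OF assms(2,4)] by blast
  have "emeasure lborel K + emeasure lborel L \<le> emeasure lborel C"
    using K L assms(5) by (intro brunn_minkowski_real_closed C) auto
  have "emeasure lborel A + emeasure lborel B
      \<le> (emeasure lborel K + ennreal (e / 2)) + (emeasure lborel L + ennreal (e / 2))"
    using K L by (intro add_mono)
  also have "\<dots> = (emeasure lborel K + emeasure lborel L) + (ennreal (e / 2) + ennreal (e / 2))"
    by (simp add: ac_simps)
  also have "ennreal (e / 2) + ennreal (e / 2) = ennreal e"
    using \<open>0 < e\<close> by (simp flip: ennreal_plus)
  also have "(emeasure lborel K + emeasure lborel L) + ennreal e \<le> emeasure lborel C + ennreal e"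
    by (intro add_right_mono) fact
  finally show "emeasure lborel A + emeasure lborel B \<le> emeasure lborel C + ennreal e" .
qed

section \<open>Level sets and a Prekopa-Leindler inequality\<close>

text \<open>Tonelli on the region 0 \<le> t < f(x): one order of integration gives f, the other the
  measures of its superlevel sets.\<close>

lemma nn_integral_layer_cake:
  fixes f :: "real \<Rightarrow> real"
  assumes [measurable]: "f \<in> borel_measurable borel" and "\<And>x. 0 \<le> f x"
  shows "(\<integral>\<^sup>+x. ennreal (f x) \<partial>lborel)
    = (\<integral>\<^sup>+t. emeasure lborel {x. t < f x} * indicator {0..} t \<partial>lborel)"
proof -
  have "(\<integral>\<^sup>+x. ennreal (f x) \<partial>lborel)
      = (\<integral>\<^sup>+x. \<integral>\<^sup>+t. (if 0 \<le> t \<and> t < f x then 1 else 0) \<partial>lborel \<partial>lborel)"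
  proof (rule nn_integral_cong)
    fix x
    have "(\<integral>\<^sup>+t. (if 0 \<le> t \<and> t < f x then 1 else 0) \<partial>lborel) = (\<integral>\<^sup>+t. indicator {0..<f x} t \<partial>lborel)"
      by (intro nn_integral_cong) (auto split: split_indicator)
    then show "ennreal (f x) = (\<integral>\<^sup>+t. (if 0 \<le> t \<and> t < f x then 1 else 0) \<partial>lborel)"
      using assms by simp
  qed
  also have "\<dots> = (\<integral>\<^sup>+t. \<integral>\<^sup>+x. (if 0 \<le> t \<and> t < f x then 1 else 0) \<partial>lborel \<partial>lborel)"
    by (rule lborel_pair.Fubini') measurable
  also have "\<dots> = (\<integral>\<^sup>+t. emeasure lborel {x. t < f x} * indicator {0..} t \<partial>lborel)"
  proof (rule nn_integral_cong)
    fix t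
    have "(\<integral>\<^sup>+x. (if 0 \<le> t \<and> t < f x then 1 else 0) \<partial>lborel)
        = (\<integral>\<^sup>+x. indicator {x. t < f x} x * indicator {0..} t \<partial>lborel)"
      by (intro nn_integral_cong) (auto split: split_indicator)
    then show "(\<integral>\<^sup>+x. (if 0 \<le> t \<and> t < f x then 1 else 0) \<partial>lborel)
        = emeasure lborel {x. t < f x} * indicator {0..} t"
      by (simp add: nn_integral_multc)
  qed
  finally show ?thesis .
qed

text \<open>If \<phi>(x)^p > t and \<psi>(y)^q > t, then \<omega>(x + y) > t^(1/p) t^(1/q) = t, so
  Brunn-Minkowski applies to the level sets at height t, and integration over t finishes. The common
  maximum 1 makes both level sets on the left nonempty for 0 \<le> t < 1 and empty for t \<ge> 1;
  Brunn-Minkowski says nothing when only one of them is empty.\<close>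

lemma prekopa_leindler_real:
  fixes \<phi> \<psi> \<omega> :: "real \<Rightarrow> real" and p q :: real
  assumes [measurable]: "\<phi> \<in> borel_measurable borel" "\<psi> \<in> borel_measurable borel"
      "\<omega> \<in> borel_measurable borel"
    and \<phi>: "\<And>x. 0 \<le> \<phi> x" "\<And>x. \<phi> x \<le> 1" "\<phi> x\<^sub>0 = 1"
    and \<psi>: "\<And>x. 0 \<le> \<psi> x" "\<And>x. \<psi> x \<le> 1" "\<psi> y\<^sub>0 = 1"
    and \<omega>: "\<And>x. 0 \<le> \<omega> x" "\<And>x y. \<phi> x * \<psi> y \<le> \<omega> (x + y)"
    and pq: "1 < p" "1 < q" "1 / p + 1 / q = 1"
  shows "(\<integral>\<^sup>+x. ennreal (\<phi> x powr p) \<partial>lborel) + (\<integral>\<^sup>+x. ennreal (\<psi> x powr q) \<partial>lborel)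
    \<le> (\<integral>\<^sup>+x. ennreal (\<omega> x) \<partial>lborel)"
proof -
  have meas [measurable]: "(\<lambda>t. emeasure lborel {x. t < f x}) \<in> borel_measurable borel"
    if [measurable]: "f \<in> borel_measurable borel" for f :: "real \<Rightarrow> real"
  proof -
    have "(\<lambda>t. emeasure lborel {x \<in> space lborel. t < f x}) \<in> borel_measurable borel"
      by measurable
    then show ?thesis by simp
  qed
  have "emeasure lborel {x. t < \<phi> x powr p} + emeasure lborel {x. t < \<psi> x powr q}
      \<le> emeasure lborel {x. t < \<omega> x}" if "0 \<le> t" for t
  proof (cases "t < 1")
    case True
    show ?thesis
    proof (rule brunn_minkowski_real)
      have "t < \<phi> x\<^sub>0 powr p" "t < \<psi> y\<^sub>0 powr q" using True \<phi> \<psi> by auto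
      then show "{x. t < \<phi> x powr p} \<noteq> {}" "{x. t < \<psi> x powr q} \<noteq> {}" by blast+
    next
      fix x y assume xy: "x \<in> {x. t < \<phi> x powr p}" "y \<in> {x. t < \<psi> x powr q}"
      have "t powr (1 / p) < (\<phi> x powr p) powr (1 / p)" "t powr (1 / q) < (\<psi> y powr q) powr (1 / q)"
        using xy pq that by (auto intro!: powr_less_mono2)
      then have "t powr (1 / p) < \<phi> x" "t powr (1 / q) < \<psi> y"
        using \<phi> \<psi> pq by (auto simp: powr_powr)
      then have "t powr (1 / p) * t powr (1 / q) < \<phi> x * \<psi> y"
        by (intro mult_strict_mono') auto
      also have "t powr (1 / p) * t powr (1 / q) = t"
        using pq that by (simp flip: powr_add)
      finally show "x + y \<in> {x. t < \<omega> x}" using \<omega>(2)[of x y] by simp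
    qed measurable
  next
    case False
    then have "\<not> t < \<phi> x powr p" "\<not> t < \<psi> x powr q" for x
      using powr_mono2[of p "\<phi> x" 1] powr_mono2[of q "\<psi> x" 1] \<phi> \<psi> pq by (auto simp: not_less intro: order_trans)
    then show ?thesis by simp
  qed
  then have "(\<integral>\<^sup>+t. emeasure lborel {x. t < \<phi> x powr p} * indicator {0..} t
        + emeasure lborel {x. t < \<psi> x powr q} * indicator {0..} t \<partial>lborel)
      \<le> (\<integral>\<^sup>+t. emeasure lborel {x. t < \<omega> x} * indicator {0..} t \<partial>lborel)"
    by (intro nn_integral_mono) (auto split: split_indicator)
  then show ?thesis
    using \<omega> by (simp add: nn_integral_layer_cake nn_integral_add)
qed

section \<open>Integrals and sums for the extended functions\<close>

text \<open>On each cell [n, n + 1) the floor is constant and the fractional part runs through [0,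
  1), so after translation all cells contribute multiples of one integral.\<close>

lemma nn_integral_floor_frac:
  fixes a :: "int \<Rightarrow> real" and c :: "real \<Rightarrow> real"
  assumes [measurable]: "c \<in> borel_measurable borel" and "\<And>n. 0 \<le> a n"
  shows "(\<integral>\<^sup>+x. ennreal (a \<lfloor>x\<rfloor> * c (frac x)) \<partial>lborel)
    = (\<integral>\<^sup>+n. ennreal (a n) \<partial>count_space UNIV) * (\<integral>\<^sup>+u. ennreal (c u) * indicator {0..1} u \<partial>lborel)"
proof -
  let ?I = "\<integral>\<^sup>+u. ennreal (c u) * indicator {0..1} u \<partial>lborel"
  \<comment> \<open>For fixed x only one cell contributes, so the integral over the counting measure
    collapses to a single term.\<close>
  have ind: "indicator {of_int n..<of_int n + 1} x = (indicator {\<lfloor>x\<rfloor>} n :: ennreal)" for n and x :: real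
    by (auto split: split_indicator simp: floor_eq_iff) linarith+
  have "(\<integral>\<^sup>+x. ennreal (a \<lfloor>x\<rfloor> * c (frac x)) \<partial>lborel)
      = (\<integral>\<^sup>+x. \<integral>\<^sup>+n. ennreal (a n * c (x - of_int n)) * indicator {of_int n..<of_int n + 1} x
          \<partial>count_space UNIV \<partial>lborel)"
    unfolding ind by (simp add: nn_integral_indicator_singleton frac_def)
  also have "\<dots> = (\<integral>\<^sup>+n. \<integral>\<^sup>+x. ennreal (a n * c (x - of_int n)) * indicator {of_int n..<of_int n + 1} x
          \<partial>lborel \<partial>count_space UNIV)"
    by (rule nn_integral_count_space_nn_integral) auto
  also have "\<dots> = (\<integral>\<^sup>+n. ennreal (a n) * ?I \<partial>count_space UNIV)"
  proof (rule nn_integral_cong)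
    fix n :: int
    have "(\<integral>\<^sup>+x. ennreal (a n * c (x - of_int n)) * indicator {of_int n..<of_int n + 1} x \<partial>lborel)
        = (\<integral>\<^sup>+u. ennreal (a n * c u) * indicator {of_int n..<of_int n + 1} (of_int n + u) \<partial>lborel)"
      by (subst nn_integral_real_affine[where c = 1 and t = "of_int n"]) auto
    also have "\<dots> = (\<integral>\<^sup>+u. ennreal (a n) * (ennreal (c u) * indicator {0..1} u) \<partial>lborel)"
    proof (rule nn_integral_cong_AE)
      \<comment> \<open>The half-open cell and the closed unit interval differ only at u = 1, a null
        set.\<close>
      show "AE u in lborel. ennreal (a n * c u) * indicator {of_int n..<of_int n + 1} (of_int n + u)
          = ennreal (a n) * (ennreal (c u) * indicator {0..1} u)"
        using AE_lborel_singleton[of "1::real"]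
      proof eventually_elim
        case (elim u)
        then show ?case
          by (cases "0 \<le> u \<and> u < 1") (auto simp: ennreal_mult' assms mult.assoc indicator_def)
      qed
    qed
    finally show "(\<integral>\<^sup>+x. ennreal (a n * c (x - of_int n)) * indicator {of_int n..<of_int n + 1} x \<partial>lborel)
        = ennreal (a n) * ?I"
      by (simp add: nn_integral_cmult)
  qed
  also have "\<dots> = (\<integral>\<^sup>+n. ennreal (a n) \<partial>count_space UNIV) * ?I"
    by (simp add: nn_integral_multc)
  finally show ?thesis .
qed

lemma nn_integral_count_space_infsum:
  fixes a :: "'a \<Rightarrow> real"
  assumes "a summable_on A" "\<And>n. 0 \<le> a n"
  shows "(\<integral>\<^sup>+n. ennreal (a n) \<partial>count_space A) = ennreal (infsum a A)"
proof -
  have "Infinite_Set_Sum.abs_summable_on a A"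
    using assms by (simp flip: abs_summable_equivalent)
  then show ?thesis
    using assms by (simp add: nn_integral_conv_infsetsum infsetsum_infsum)
qed

text \<open>For \<delta> < 1 the integrals are (1 - \<delta>)/(- ln \<delta>) and (1 -
  \<delta>^2)/(- 2 ln \<delta>); factoring 1 - \<delta>^2 gives the ratio (1 + \<delta>)/2, the
  source of 1 + \<delta> in the bound. The case \<delta> = 1 is separate because ln \<delta>
  vanishes.\<close>

lemma nn_integral_powr_unit_interval:
  fixes \<delta> :: real
  assumes "0 < \<delta>" "\<delta> \<le> 1"
  obtains J :: real where "0 < J"
    "(\<integral>\<^sup>+u. ennreal (\<delta> powr u) * indicator {0..1} u \<partial>lborel) = ennreal J"
    "(\<integral>\<^sup>+u. ennreal (\<delta> powr (2 * u)) * indicator {0..1} u \<partial>lborel) = ennreal ((1 + \<delta>) / 2 * J)"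
proof (cases "\<delta> = 1")
  case True
  then show ?thesis by (intro that[of 1]) auto
next
  case False
  then have l: "ln \<delta> < 0" using assms by simp
  have I: "(\<integral>\<^sup>+u. ennreal (\<delta> powr (r * u)) * indicator {0..1} u \<partial>lborel)
      = ennreal (\<delta> powr r / (r * ln \<delta>) - 1 / (r * ln \<delta>))" if "0 < r" for r
  proof -
    have "((\<lambda>u. \<delta> powr (r * u) / (r * ln \<delta>)) has_real_derivative \<delta> powr (r * u)) (at u)" for u
      using assms l that by (auto intro!: derivative_eq_intros simp: powr_def)
    then have "(\<integral>\<^sup>+u. ennreal (\<delta> powr (r * u)) * indicator {0..1} u \<partial>lborel)
      = ennreal (\<delta> powr (r * 1) / (r * ln \<delta>) - \<delta> powr (r * 0) / (r * ln \<delta>))"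
      by (intro nn_integral_FTC_Icc) (auto intro: DERIV_subset)
    then show ?thesis using assms by simp
  qed
  show ?thesis
  proof (rule that)
    show "0 < (1 - \<delta>) / - ln \<delta>" using l assms False by (simp add: field_simps)
    show "(\<integral>\<^sup>+u. ennreal (\<delta> powr u) * indicator {0..1} u \<partial>lborel) = ennreal ((1 - \<delta>) / - ln \<delta>)"
      using I[of 1] assms l by (simp add: field_simps)
    have "\<delta> powr 2 / (2 * ln \<delta>) - 1 / (2 * ln \<delta>) = (1 + \<delta>) / 2 * ((1 - \<delta>) / - ln \<delta>)"
      using assms l by (simp add: field_simps power2_eq_square)
    then show "(\<integral>\<^sup>+u. ennreal (\<delta> powr (2 * u)) * indicator {0..1} u \<partial>lborel)
        = ennreal ((1 + \<delta>) / 2 * ((1 - \<delta>) / - ln \<delta>))"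
      using I[of 2] by simp
  qed
qed

text \<open>Each term is at most the whole sum, so g^p = g^(p-1) g is dominated by a constant
  multiple of g.\<close>

lemma summable_on_powr:
  fixes g :: "'a \<Rightarrow> real"
  assumes "g summable_on A" "\<And>x. 0 \<le> g x" "1 \<le> p"
  shows "(\<lambda>x. g x powr p) summable_on A"
proof (rule summable_on_comparison_test)
  show "(\<lambda>x. infsum g A powr (p - 1) * g x) summable_on A"
    by (rule summable_on_cmult_right) fact
  fix x assume "x \<in> A"
  then have "g x \<le> infsum g A"
    using finite_sum_le_infsum[of g A "{x}"] assms by simp
  then have "g x powr (p - 1) * g x \<le> infsum g A powr (p - 1) * g x"
    using assms by (intro mult_right_mono powr_mono2) auto
  then show "g x powr p \<le> infsum g A powr (p - 1) * g x"
    using assms by (simp add: powr_mult_base powr_diff split: if_splits)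
qed simp

section \<open>The weighted inequality on the integers\<close>

text \<open>The two domination hypotheses on \<open>W\<close> record the values 1 and \<delta> of f
  at the shifts 0 and 1. Keeping \<open>W\<close> an arbitrary majorant allows functions other than
  f \<star> g \<star> h, as \<delta> = 0 will require.\<close>

lemma weighted_prekopa_leindler_int:
  fixes g h W :: "int \<Rightarrow> real" and \<delta> p q :: real
  assumes \<delta>: "0 < \<delta>" "\<delta> \<le> 1"
    and g: "\<And>n. 0 \<le> g n" "\<And>n. g n \<le> 1" "g i = 1" "g summable_on UNIV"
    and h: "\<And>n. 0 \<le> h n" "\<And>n. h n \<le> 1" "h j = 1" "h summable_on UNIV"
    and W: "\<And>n. 0 \<le> W n" "W summable_on UNIV" "\<And>m n. g m * h n \<le> W (m + n)"
      "\<And>m n. \<delta> * (g m * h n) \<le> W (m + n + 1)"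
    and pq: "1 < p" "1 < q" "1 / p + 1 / q = 1"
  shows "p powr (1 / p) * q powr (1 / q) / 2 * (1 + \<delta>) * (lp_norm p g * lp_norm q h) \<le> infsum W UNIV"
proof -
  define C where "C = p powr (1 / p) * q powr (1 / q)"
  define a where "a = infsum (\<lambda>n. g n powr p) UNIV"
  define b where "b = infsum (\<lambda>n. h n powr q) UNIV"
  let ?I = "\<lambda>c. \<integral>\<^sup>+u. ennreal (c u) * indicator {0..1} u \<partial>lborel"
  have sum_g: "(\<lambda>n. g n powr p) summable_on UNIV" and sum_h: "(\<lambda>n. h n powr q) summable_on UNIV"
    using g h pq by (auto intro: summable_on_powr)
  have nonneg: "0 \<le> a" "0 \<le> b" "0 \<le> C"
    by (auto simp: a_def b_def C_def intro!: infsum_nonneg)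
  have ln: "lp_norm p g = a powr (1 / p)" "lp_norm q h = b powr (1 / q)"
    using g h by (auto simp: lp_norm_def a_def b_def)
  obtain J where J: "0 < J" "?I (\<lambda>u. \<delta> powr u) = ennreal J"
      "?I (\<lambda>u. \<delta> powr (2 * u)) = ennreal ((1 + \<delta>) / 2 * J)"
    using nn_integral_powr_unit_interval[OF \<delta>] by metis
  have dp: "\<delta> powr u \<le> 1" if "0 \<le> u" for u
    using \<delta> that powr_mono'[of 0 u \<delta>] by simp
  define G where "G x = g \<lfloor>x\<rfloor> * \<delta> powr frac x" for x :: real
  define H where "H x = h \<lfloor>x\<rfloor> * \<delta> powr frac x" for x :: real
  define \<omega> where "\<omega> x = W \<lfloor>x\<rfloor> * \<delta> powr frac x" for x :: real
  have "(\<integral>\<^sup>+x. ennreal (G x powr p) \<partial>lborel) + (\<integral>\<^sup>+x. ennreal (H x powr q) \<partial>lborel)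
      \<le> (\<integral>\<^sup>+x. ennreal (\<omega> x) \<partial>lborel)"
  proof (rule prekopa_leindler_real[where x\<^sub>0 = "of_int i" and y\<^sub>0 = "of_int j"])
    have [measurable]: "frac \<in> borel_measurable (borel :: real measure)"
      unfolding frac_def by measurable
    show "G \<in> borel_measurable borel" "H \<in> borel_measurable borel" "\<omega> \<in> borel_measurable borel"
      unfolding G_def H_def \<omega>_def by measurable
    show "0 \<le> G x" "0 \<le> H x" "0 \<le> \<omega> x" for x
      using g h W by (auto simp: G_def H_def \<omega>_def)
    show "G x \<le> 1" "H x \<le> 1" for x
      using g h dp by (auto simp: G_def H_def intro!: mult_le_one)
    show "G (of_int i) = 1" "H (of_int j) = 1"
      using g h \<delta> by (auto simp: G_def H_def)
    show "G x * H y \<le> \<omega> (x + y)" for x y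
    proof (cases "frac x + frac y < 1")
      case True
      have "G x * H y = (g \<lfloor>x\<rfloor> * h \<lfloor>y\<rfloor>) * \<delta> powr (frac x + frac y)"
        by (simp add: G_def H_def powr_add)
      also have "\<dots> \<le> W (\<lfloor>x\<rfloor> + \<lfloor>y\<rfloor>) * \<delta> powr (frac x + frac y)"
        by (intro mult_right_mono W) simp
      also have "\<dots> = \<omega> (x + y)"
        using True by (simp add: \<omega>_def frac_add floor_add)
      finally show ?thesis .
    next
      case False
      \<comment> \<open>After a carry, frac (x + y) = frac x + frac y - 1; the factor \<delta> split
        off here is the one in the second domination hypothesis.\<close>
      have "G x * H y = (\<delta> * (g \<lfloor>x\<rfloor> * h \<lfloor>y\<rfloor>)) * \<delta> powr (frac x + frac y - 1)"
        using \<delta> by (simp add: G_def H_def powr_add powr_diff)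
      also have "\<dots> \<le> W (\<lfloor>x\<rfloor> + \<lfloor>y\<rfloor> + 1) * \<delta> powr (frac x + frac y - 1)"
        by (intro mult_right_mono W) simp
      also have "\<dots> = \<omega> (x + y)"
        using False by (simp add: \<omega>_def frac_add floor_add)
      finally show ?thesis .
    qed
  qed (use pq in auto)
  also have "(\<integral>\<^sup>+x. ennreal (G x powr p) \<partial>lborel) = ennreal a * ?I (\<lambda>u. (\<delta> powr u) powr p)"
    unfolding G_def powr_mult a_def
    by (subst nn_integral_floor_frac) (auto simp: nn_integral_count_space_infsum sum_g)
  also have "(\<integral>\<^sup>+x. ennreal (H x powr q) \<partial>lborel) = ennreal b * ?I (\<lambda>u. (\<delta> powr u) powr q)"
    unfolding H_def powr_mult b_def
    by (subst nn_integral_floor_frac) (auto simp: nn_integral_count_space_infsum sum_h)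
  also have "(\<integral>\<^sup>+x. ennreal (\<omega> x) \<partial>lborel) = ennreal (infsum W UNIV) * ennreal J"
    unfolding \<omega>_def
    by (subst nn_integral_floor_frac) (auto simp: nn_integral_count_space_infsum W J)
  finally have main: "ennreal a * ?I (\<lambda>u. (\<delta> powr u) powr p) + ennreal b * ?I (\<lambda>u. (\<delta> powr u) powr q)
      \<le> ennreal (infsum W UNIV * J)"
    using J by (simp add: ennreal_mult infsum_nonneg W)
  have "ennreal (C * (lp_norm p g * lp_norm q h) * ((1 + \<delta>) / 2 * J))
      = ennreal (C * (lp_norm p g * lp_norm q h)) * ?I (\<lambda>u. \<delta> powr (2 * u))"
    unfolding J using nonneg ln \<delta> J by (subst ennreal_mult) auto
  also have "\<dots> = (\<integral>\<^sup>+u. ennreal (C * (lp_norm p g * lp_norm q h)) * (ennreal (\<delta> powr (2 * u)) * indicator {0..1} u) \<partial>lborel)"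
    by (simp add: nn_integral_cmult)
  also have "\<dots> \<le> (\<integral>\<^sup>+u. ennreal a * (ennreal ((\<delta> powr u) powr p) * indicator {0..1} u)
      + ennreal b * (ennreal ((\<delta> powr u) powr q) * indicator {0..1} u) \<partial>lborel)"
  proof (rule nn_integral_mono)
    fix u :: real
    \<comment> \<open>Young is applied separately at each u. The product on the left carries
      \<delta>^(2u) whatever p is, hence the same factor (1 + \<delta>)/2 for all p.\<close>
    have "C * (a powr (1 / p) * \<delta> powr u) * (b powr (1 / q) * \<delta> powr u)
        \<le> (a powr (1 / p) * \<delta> powr u) powr p + (b powr (1 / q) * \<delta> powr u) powr q"
      unfolding C_def using pq by (intro weighted_young) auto
    also have "\<dots> = a * (\<delta> powr u) powr p + b * (\<delta> powr u) powr q"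
      using pq nonneg by (simp add: powr_mult powr_powr)
    finally have "C * (lp_norm p g * lp_norm q h) * \<delta> powr (2 * u)
        \<le> a * (\<delta> powr u) powr p + b * (\<delta> powr u) powr q"
      unfolding ln mult_2 powr_add by (simp add: mult_ac)
    then have "ennreal (C * (lp_norm p g * lp_norm q h) * \<delta> powr (2 * u))
        \<le> ennreal (a * (\<delta> powr u) powr p + b * (\<delta> powr u) powr q)"
      by (rule ennreal_leI)
    then show "ennreal (C * (lp_norm p g * lp_norm q h)) * (ennreal (\<delta> powr (2 * u)) * indicator {0..1} u)
        \<le> ennreal a * (ennreal ((\<delta> powr u) powr p) * indicator {0..1} u)
          + ennreal b * (ennreal ((\<delta> powr u) powr q) * indicator {0..1} u)"
      using nonneg ln by (auto simp: ennreal_mult ennreal_plus split: split_indicator)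
  qed
  also have "\<dots> = ennreal a * ?I (\<lambda>u. (\<delta> powr u) powr p) + ennreal b * ?I (\<lambda>u. (\<delta> powr u) powr q)"
    by (simp add: nn_integral_add nn_integral_cmult)
  also note main
  finally have "C * (lp_norm p g * lp_norm q h) * ((1 + \<delta>) / 2 * J) \<le> infsum W UNIV * J"
    using J by (subst (asm) ennreal_le_iff) (auto intro!: mult_nonneg_nonneg infsum_nonneg W)
  then have "(C / 2 * (1 + \<delta>) * (lp_norm p g * lp_norm q h)) * J \<le> infsum W UNIV * J"
    by (simp add: mult_ac)
  then show ?thesis
    using J by (simp add: C_def)
qed

section \<open>Maxima, norms and bounds for max-convolution\<close>

text \<open>Summability allows at most (sum of g)/g(k) indices with g(n) \<ge> g(k) > 0. A maximum
  over this finite set is global, since g(n) < g(k) outside it. This permits normalising the maximum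
  to 1.\<close>

lemma nonneg_l1_attains_max:
  assumes "nonneg_l1 g"
  obtains i where "0 < g i" "\<And>n. g n \<le> g i"
proof -
  have g: "\<And>x. 0 \<le> g x" "g summable_on UNIV" and "g \<noteq> (\<lambda>_. 0)"
    using assms by (auto simp: nonneg_l1_def)
  then obtain k where k: "0 < g k" by (metis ext order_le_less)
  define S where "S = {n. g k \<le> g n}"
  have "finite S"
  proof (rule conjunct1[OF finite_if_finite_subsets_card_bdd])
    fix F assume F: "F \<subseteq> S" "finite F"
    have "real (card F) * g k = (\<Sum>n\<in>F. g k)" by simp
    also have "\<dots> \<le> sum g F" using F by (intro sum_mono) (auto simp: S_def)
    also have "\<dots> \<le> infsum g UNIV" using F g by (intro finite_sum_le_infsum) auto
    finally have "real (card F) \<le> infsum g UNIV / g k" using k by (simp add: field_simps)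
    then show "card F \<le> nat \<lceil>infsum g UNIV / g k\<rceil>" by linarith
  qed
  have "k \<in> S" by (simp add: S_def)
  then obtain i where i: "i \<in> S" "g i = Max (g ` S)"
    using \<open>finite S\<close> Max_in[of "g ` S"] by (metis empty_iff finite_imageI image_iff image_is_empty)
  show ?thesis
  proof (rule that)
    show "0 < g i" using i k by (auto simp: S_def)
    fix n show "g n \<le> g i"
    proof (cases "n \<in> S")
      case True then show ?thesis using i \<open>finite S\<close> by simp
    next
      case False then show ?thesis using i by (auto simp: S_def)
    qed
  qed
qed

lemma lp_norm_pos:
  assumes "nonneg_l1 g" "1 \<le> p"
  shows "0 < lp_norm p g"
proof -
  obtain i where i: "0 < g i" using nonneg_l1_attains_max assms by blast
  have "(\<lambda>x. g x powr p) summable_on UNIV"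
    using assms by (intro summable_on_powr) (auto simp: nonneg_l1_def)
  then have "g i powr p \<le> (\<Sum>\<^sub>\<infinity>x. g x powr p)"
    using finite_sum_le_infsum[of "\<lambda>x. g x powr p" UNIV "{i}"] by simp
  moreover have "0 < g i powr p" using i by simp
  ultimately have "(\<Sum>\<^sub>\<infinity>x. g x powr p) \<noteq> 0" by linarith
  moreover have "\<bar>g x\<bar> = g x" for x using assms by (simp add: nonneg_l1_def)
  ultimately show ?thesis by (simp add: lp_norm_def)
qed

lemma lp_norm_divide:
  assumes "0 < c" "0 < p"
  shows "lp_norm p (\<lambda>x. g x / c) = lp_norm p g / c"
proof -
  have "(\<Sum>\<^sub>\<infinity>x. \<bar>g x / c\<bar> powr p) = (\<Sum>\<^sub>\<infinity>x. \<bar>g x\<bar> powr p * (1 / c powr p))"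
    using assms by (simp add: powr_divide)
  also have "\<dots> = (\<Sum>\<^sub>\<infinity>x. \<bar>g x\<bar> powr p) / c powr p"
    by (subst infsum_cmult_left') simp
  finally show ?thesis
    using assms by (simp add: lp_norm_def powr_divide powr_powr)
qed

text \<open>The products are bounded by A B, so the real \<open>SUP\<close> is a genuine supremum.
  The conclusions have the form of the hypotheses on \<open>f\<close>, so the lemma can be iterated
  for a triple convolution.\<close>

lemma maxconv_bounds:
  assumes f: "\<And>x. 0 \<le> f x" "\<And>x. f x \<le> A" and g: "\<And>x. 0 \<le> g x" "\<And>x. g x \<le> B"
  shows "0 \<le> maxconv f g x" "maxconv f g x \<le> A * B" "f s * g t \<le> maxconv f g (s + t)"
proof -
  have le: "f s * g t \<le> A * B" for s t
    using order_trans[OF f] by (intro mult_mono f g) auto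
  have ge: "f s * g (x - s) \<le> maxconv f g x" for s x
    unfolding maxconv_def by (rule cSUP_upper) (auto intro!: bdd_aboveI2[where M = "A * B"] le)
  show "f s * g t \<le> maxconv f g (s + t)" using ge[of s "s + t"] by simp
  show "0 \<le> maxconv f g x" using ge[of 0 x] f g by (metis mult_nonneg_nonneg order_trans)
  show "maxconv f g x \<le> A * B" unfolding maxconv_def by (intro cSUP_least le) auto
qed

lemma maxconv_indicator_0:
  assumes "\<And>x. 0 \<le> f x"
  shows "maxconv f (\<lambda>x. if x = 0 then 1 else 0) = f"
proof
  fix x
  show "maxconv f (\<lambda>x. if x = 0 then 1 else 0) x = f x"
    unfolding maxconv_def
  proof (rule cSup_eq_maximum)
    show "f x \<in> range (\<lambda>t. f t * (if x - t = 0 then 1 else 0))"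
      by (rule image_eqI[of _ _ x]) auto
  qed (use assms in auto)
qed

section \<open>The two-point function\<close>

text \<open>Both sides are homogeneous of degree 1 in g and in h, so division by the maxima reduces
  to the normalised inequality.\<close>

lemma maxconv_two_point_lower_bound:
  fixes \<delta> p q :: real
  assumes \<delta>: "0 \<le> \<delta>" "\<delta> \<le> 1" and g: "nonneg_l1 g" and h: "nonneg_l1 h"
    and f: "f = (\<lambda>x::int. (if x = 0 then 1 else 0) + \<delta> * (if x = 1 then 1 else 0))"
    and sum: "maxconv (maxconv f g) h summable_on UNIV"
    and pq: "1 < p" "1 < q" "1 / p + 1 / q = 1"
  shows "p powr (1 / p) * q powr (1 / q) / 2 * (1 + \<delta>) * (lp_norm p g * lp_norm q h)
    \<le> infsum (maxconv (maxconv f g) h) UNIV"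
proof -
  define W where "W = maxconv (maxconv f g) h"
  obtain i where i: "0 < g i" "\<And>n. g n \<le> g i" using nonneg_l1_attains_max g by blast
  obtain j where j: "0 < h j" "\<And>n. h n \<le> h j" using nonneg_l1_attains_max h by blast
  have g0: "\<And>n. 0 \<le> g n" "g summable_on UNIV" and h0: "\<And>n. 0 \<le> h n" "h summable_on UNIV"
    using g h by (auto simp: nonneg_l1_def)
  have f0: "0 \<le> f x" "f x \<le> 1" for x using \<delta> by (auto simp: f)
  have fg: "0 \<le> maxconv f g x" "maxconv f g x \<le> 1 * g i" "f s * g t \<le> maxconv f g (s + t)" for x s t
    by (rule maxconv_bounds f0 g0 i)+
  have W0: "0 \<le> W x" and fgh: "maxconv f g s * h t \<le> W (s + t)" for x s t
    unfolding W_def by (rule maxconv_bounds fg h0 j)+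
  have Wf: "f s * (g m * h n) \<le> W (s + m + n)" for s m n
    using mult_right_mono[OF fg(3)[of s m] h0(1)[of n]] fgh[of "s + m" n] by (simp add: mult_ac)
  have W1: "g m * h n \<le> W (m + n)" for m n
    using Wf[of 0 m n] by (simp add: f)
  have W2: "\<delta> * (g m * h n) \<le> W (m + n + 1)" for m n
    using Wf[of 1 m n] by (simp add: f add_ac)
  let ?c = "g i * h j"
  \<comment> \<open>General in \<epsilon> and V because it serves twice: with \<delta> and W if
    \<delta> > 0, and with 1 and W(n) + W(n - 1) if \<delta> = 0.\<close>
  have scaled: "p powr (1 / p) * q powr (1 / q) / 2 * (1 + \<epsilon>) * (lp_norm p g * lp_norm q h) \<le> infsum V UNIV"
    if \<epsilon>: "0 < \<epsilon>" "\<epsilon> \<le> 1" and V: "\<And>n. 0 \<le> V n" "V summable_on UNIV" "\<And>m n. g m * h n \<le> V (m + n)"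
      "\<And>m n. \<epsilon> * (g m * h n) \<le> V (m + n + 1)" for \<epsilon> :: real and V
  proof -
    have "p powr (1 / p) * q powr (1 / q) / 2 * (1 + \<epsilon>)
        * (lp_norm p (\<lambda>n. g n / g i) * lp_norm q (\<lambda>n. h n / h j)) \<le> infsum (\<lambda>n. V n / ?c) UNIV"
    proof (rule weighted_prekopa_leindler_int[where i = i and j = j])
      show "g m / g i * (h n / h j) \<le> V (m + n) / ?c" for m n
        using divide_right_mono[OF V(3), of ?c m n] i j by simp
      show "\<epsilon> * (g m / g i * (h n / h j)) \<le> V (m + n + 1) / ?c" for m n
        using divide_right_mono[OF V(4), of ?c m n] i j by simp
      show "(\<lambda>n. g n / g i) summable_on UNIV" "(\<lambda>n. h n / h j) summable_on UNIV" "(\<lambda>n. V n / ?c) summable_on UNIV"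
        using g0 h0 V by (auto simp: divide_inverse intro!: summable_on_cmult_left)
    qed (use \<epsilon> pq i j g0 h0 V in auto)
    also have "infsum (\<lambda>n. V n / ?c) UNIV = infsum V UNIV / ?c"
      using infsum_cmult_left'[of V "1 / ?c" UNIV] by simp
    also have "lp_norm p (\<lambda>n. g n / g i) * lp_norm q (\<lambda>n. h n / h j) = lp_norm p g * lp_norm q h / ?c"
      using i j pq by (simp add: lp_norm_divide)
    finally show ?thesis using i j by (simp add: divide_simps)
  qed
  show ?thesis
  proof (cases "\<delta> = 0")
    case False
    then show ?thesis
      using scaled[of \<delta> W] \<delta> W0 W1 W2 sum by (simp add: W_def)
  next
    case True
    \<comment> \<open>Since 0 powr 0 = 0, the extension by powers of \<delta> is useless here; reduce to the case \<delta> = 1 at the cost of doubling the sum of W.\<close>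
    have bij: "bij_betw (\<lambda>n. n - 1) UNIV (UNIV :: int set)"
      by (rule bij_betwI[where g = "\<lambda>n. n + 1"]) auto
    have sW: "W summable_on UNIV" "(\<lambda>n. W (n - 1)) summable_on UNIV"
      using sum summable_on_reindex_bij_betw[OF bij, of W] by (auto simp: W_def)
    have "p powr (1 / p) * q powr (1 / q) / 2 * (1 + 1) * (lp_norm p g * lp_norm q h)
        \<le> infsum (\<lambda>n. W n + W (n - 1)) UNIV"
    proof (rule scaled)
      show "g m * h n \<le> W (m + n) + W (m + n - 1)" for m n
        using W1[of m n] W0[of "m + n - 1"] by simp
      \<comment> \<open>The shifted summand contributes W(m + n) at the point m + n + 1.\<close>
      show "1 * (g m * h n) \<le> W (m + n + 1) + W (m + n + 1 - 1)" for m n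
        using W1[of m n] W0[of "m + n + 1"] by simp
    qed (use sW W0 in \<open>auto intro: summable_on_add\<close>)
    also have "\<dots> = infsum W UNIV + infsum W UNIV"
      using sW infsum_reindex_bij_betw[OF bij, of W] by (simp add: infsum_add)
    finally show ?thesis using True by (simp add: W_def)
  qed
qed

theorem mainTheorem14:
  fixes \<delta> :: real
  assumes "0 \<le> \<delta>" "\<delta> \<le> 1"
  defines "f \<equiv> (\<lambda>x::int. (if x = 0 then 1 else 0) + \<delta> * (if x = 1 then 1 else 0))"
  shows "gamma f = 1 + \<delta> \<and>
         (\<forall>p q. 1 < p \<longrightarrow> q = p / (p - 1) \<longrightarrow>
           gamma_p p f \<ge> p powr (1 / p) * q powr (1 / q) / 2 * (1 + \<delta>))"
proof -
  define R where "R p = {(\<Sum>\<^sub>\<infinity>x. maxconv (maxconv f g) h x) / (lp_norm p g * lp_norm (p / (p - 1)) h)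
      | g h. nonneg_l1 g \<and> nonneg_l1 h \<and> maxconv (maxconv f g) h summable_on UNIV}" for p
  have R: "gamma_p p f = Inf (R p)" for p by (simp add: gamma_p_def R_def)
  \<comment> \<open>The point mass at 0 is neutral for max-convolution and all its norms are 1, so
    the pair (e, e) has as its ratio the sum of f.\<close>
  define e :: "int \<Rightarrow> real" where "e = (\<lambda>x. if x = 0 then 1 else 0)"
  have f0: "0 \<le> f x" for x using assms by (auto simp: f_def)
  have f_sum: "(f has_sum (1 + \<delta>)) UNIV"
    by (rule has_sum_finite_neutralI[of "{0, 1}"]) (auto simp: f_def)
  have e_sum: "(e has_sum 1) UNIV"
    by (rule has_sum_finite_neutralI[of "{0}"]) (auto simp: e_def)
  have e: "nonneg_l1 e"
    using e_sum by (auto simp: nonneg_l1_def e_def fun_eq_iff intro: has_sum_imp_summable)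
  have fee: "maxconv (maxconv f e) e = f"
    by (simp add: e_def maxconv_indicator_0 f0)
  have "(\<lambda>x. \<bar>e x\<bar> powr p) = e" for p by (auto simp: e_def)
  then have "lp_norm p e = 1" for p
    using infsumI[OF e_sum] by (simp add: lp_norm_def)
  then have mem: "1 + \<delta> \<in> R p" for p
    unfolding R_def using e fee infsumI[OF f_sum] has_sum_imp_summable[OF f_sum]
    by (intro CollectI exI[of _ e]) auto
  have lower: "p powr (1 / p) * q powr (1 / q) / 2 * (1 + \<delta>) \<le> r"
    if p: "1 < p" and q: "q = p / (p - 1)" and "r \<in> R p" for p q r
  proof -
    obtain g h where gh: "nonneg_l1 g" "nonneg_l1 h" "maxconv (maxconv f g) h summable_on UNIV"
      and r: "r = (\<Sum>\<^sub>\<infinity>x. maxconv (maxconv f g) h x) / (lp_norm p g * lp_norm q h)"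
      using \<open>r \<in> R p\<close> q by (auto simp: R_def)
    have pq: "1 < p" "1 < q" "1 / p + 1 / q = 1"
      unfolding q using p by (auto simp: divide_simps)
    \<comment> \<open>Positivity turns the product bound into a bound on the quotient; real division
      by 0 would give 0.\<close>
    have "0 < lp_norm p g * lp_norm q h"
      using gh pq by (intro mult_pos_pos lp_norm_pos) auto
    then show ?thesis
      using maxconv_two_point_lower_bound[OF assms(1,2) gh(1,2) f_def[THEN meta_eq_to_obj_eq] gh(3) pq]
      by (simp add: r pos_le_divide_eq)
  qed
  \<comment> \<open>The member 1 + \<delta> also shows that the set of ratios is nonempty, which a
    lower bound on a real infimum requires.\<close>
  have bound: "p powr (1 / p) * q powr (1 / q) / 2 * (1 + \<delta>) \<le> gamma_p p f"
    if "1 < p" "q = p / (p - 1)" for p q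
    unfolding R using mem lower[OF that] by (intro cInf_greatest) auto
  have "bdd_below (R 2)"
    by (rule bdd_belowI, rule lower[of 2 2]) auto
  then have "gamma f \<le> 1 + \<delta>"
    unfolding gamma_def R by (intro cInf_lower mem)
  moreover have "1 + \<delta> \<le> gamma f"
    \<comment> \<open>For p = q = 2 the constant is sqrt 2 * sqrt 2 / 2 = 1.\<close>
    using bound[of 2 2] by (simp add: gamma_def powr_half_sqrt)
  ultimately show ?thesis using bound by auto
qed

end
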